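(* Let $(S,\cdot)$ be a semigroup satisfying the Strong Følner Condition, let $\sim$ be the relation on $S$ defined by $a\sim b$ iff there exists $x\in S$ with $ax=bx$, let $T=S/\!\sim$ (a cancellative semigroup), let $h:S\to T$ be the projection map, and let $\widetilde h:\beta S\to\beta T$ be its continuous extension. If there is an element of $\Delta(S)$ which is right cancelable in $\beta S$, then $\widetilde h:\beta S\to\beta T$ is an isomorphism.
   Context: $S$ satisfies the Strong Følner Condition (SFC) if for every finite nonempty $H\subseteq S$ and every $\epsilon>0$ there is a finite nonempty $K\subseteq S$ with $|K\setminus sK|<\epsilon|K|$ for all $s\in H$. For such $S$ and $A\subseteq S$, the Følner density $d(A)$ is the supremum of $\alpha\in[0,1]$ such that for every finite nonempty $H\subseteq S$ and every $\epsilon>0$ there is a finite nonempty $K\subseteq S$ with $|K\setminus sK|<\epsilon|K|$ for all $s\in H$ and $|A\cap K|\ge\alpha|K|$. The Stone–Čech compactification $\beta S$ is the set of ultrafilters on $S$, with the operation of $S$ extended to make $\beta S$ a right topological semigroup; $\Delta(S)=\{p\in\beta S: d(A)>0$ for all $A\in p\}$. The relation $\sim$ is an equivalence relation and $T$ is a cancellative semigroup satisfying SFC; $\widetilde h$ is a surjective homomorphism. An element $p\in\beta S$ is right cancelable in $\beta S$ if $xp=yp$ implies $x=y$ for $x,y\in\beta S$. *)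

theory Defs
  imports "HOL-Analysis.Analysis"
begin

text \<open>A semigroup is given by a carrier set \<open>S\<close> and an operation \<open>m\<close>; a type class will not do,
  because the quotient \<open>S/\<sim>\<close> and the compactifications are semigroups on sets that are not types.\<close>

definition is_semigroup :: "'a set \<Rightarrow> ('a \<Rightarrow> 'a \<Rightarrow> 'a) \<Rightarrow> bool" where
  "is_semigroup S m \<longleftrightarrow>
     (\<forall>x\<in>S. \<forall>y\<in>S. m x y \<in> S) \<and>
     (\<forall>x\<in>S. \<forall>y\<in>S. \<forall>z\<in>S. m (m x y) z = m x (m y z))"

definition is_cancellative :: "'a set \<Rightarrow> ('a \<Rightarrow> 'a \<Rightarrow> 'a) \<Rightarrow> bool" where
  "is_cancellative S m \<longleftrightarrow>
     (\<forall>x\<in>S. \<forall>y\<in>S. \<forall>z\<in>S. (m z x = m z y \<longrightarrow> x = y) \<and> (m x z = m y z \<longrightarrow> x = y))"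

definition is_semigroup_iso ::
  "'a set \<Rightarrow> ('a \<Rightarrow> 'a \<Rightarrow> 'a) \<Rightarrow> 'b set \<Rightarrow> ('b \<Rightarrow> 'b \<Rightarrow> 'b) \<Rightarrow> ('a \<Rightarrow> 'b) \<Rightarrow> bool" where
  "is_semigroup_iso S m T n f \<longleftrightarrow>
     bij_betw f S T \<and> (\<forall>x\<in>S. \<forall>y\<in>S. f (m x y) = n (f x) (f y))"


section \<open>Folner density\<close>

definition is_folner_set ::
  "'a set \<Rightarrow> ('a \<Rightarrow> 'a \<Rightarrow> 'a) \<Rightarrow> 'a set \<Rightarrow> real \<Rightarrow> 'a set \<Rightarrow> bool" where
  "is_folner_set S m H \<epsilon> K \<longleftrightarrow>
     finite K \<and> K \<noteq> {} \<and> K \<subseteq> S \<and>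
     (\<forall>s\<in>H. real (card (K - m s ` K)) < \<epsilon> * real (card K))"

definition SFC :: "'a set \<Rightarrow> ('a \<Rightarrow> 'a \<Rightarrow> 'a) \<Rightarrow> bool" where
  "SFC S m \<longleftrightarrow>
     (\<forall>H \<epsilon>. finite H \<and> H \<noteq> {} \<and> H \<subseteq> S \<and> \<epsilon> > 0 \<longrightarrow> (\<exists>K. is_folner_set S m H \<epsilon> K))"

text \<open>If \<open>SFC S m\<close> holds, then the set below contains \<open>0\<close>, so that \<open>Sup\<close> is the true supremum.\<close>

definition folner_density :: "'a set \<Rightarrow> ('a \<Rightarrow> 'a \<Rightarrow> 'a) \<Rightarrow> 'a set \<Rightarrow> real" where
  "folner_density S m A =
     Sup {\<alpha> \<in> {0..1}. \<forall>H \<epsilon>. finite H \<and> H \<noteq> {} \<and> H \<subseteq> S \<and> \<epsilon> > 0 \<longrightarrow>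
            (\<exists>K. is_folner_set S m H \<epsilon> K \<and> real (card (A \<inter> K)) \<ge> \<alpha> * real (card K))}"


section \<open>The Stone-Cech compactification of a discrete semigroup\<close>

definition is_ultrafilter_on :: "'a set \<Rightarrow> 'a set set \<Rightarrow> bool" where
  "is_ultrafilter_on S p \<longleftrightarrow>
     p \<subseteq> Pow S \<and> S \<in> p \<and> {} \<notin> p \<and>
     (\<forall>A\<in>p. \<forall>B\<in>p. A \<inter> B \<in> p) \<and>
     (\<forall>A\<in>p. \<forall>B. A \<subseteq> B \<and> B \<subseteq> S \<longrightarrow> B \<in> p) \<and>
     (\<forall>A. A \<subseteq> S \<longrightarrow> A \<in> p \<or> S - A \<in> p)"

definition beta :: "'a set \<Rightarrow> 'a set set set" where
  "beta S = {p. is_ultrafilter_on S p}"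

definition beta_topology :: "'a set \<Rightarrow> 'a set set topology" where
  "beta_topology S = topology_generated_by {{p \<in> beta S. A \<in> p} | A. A \<subseteq> S}"

definition principal_ultrafilter :: "'a set \<Rightarrow> 'a \<Rightarrow> 'a set set" where
  "principal_ultrafilter S s = {A. A \<subseteq> S \<and> s \<in> A}"

text \<open>\<open>A \<in> p \<cdot> q\<close> iff \<open>{x. x\<inverse>A \<in> q} \<in> p\<close>. This is the extension of the operation for which
  \<open>x \<mapsto> x \<cdot> p\<close> is continuous for every \<open>p\<close>, and \<open>x \<mapsto> s \<cdot> x\<close> for every \<open>s \<in> S\<close>; see
  \<open>beta_mult_principal\<close>, \<open>continuous_beta_mult_right\<close> and \<open>continuous_beta_mult_left\<close>.\<close>

definition beta_mult ::
  "'a set \<Rightarrow> ('a \<Rightarrow> 'a \<Rightarrow> 'a) \<Rightarrow> 'a set set \<Rightarrow> 'a set set \<Rightarrow> 'a set set" where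
  "beta_mult S m p q = {A. A \<subseteq> S \<and> {x \<in> S. {y \<in> S. m x y \<in> A} \<in> q} \<in> p}"

definition Delta :: "'a set \<Rightarrow> ('a \<Rightarrow> 'a \<Rightarrow> 'a) \<Rightarrow> 'a set set set" where
  "Delta S m = {p \<in> beta S. \<forall>A\<in>p. folner_density S m A > 0}"

definition right_cancelable :: "'a set \<Rightarrow> ('a \<Rightarrow> 'a \<Rightarrow> 'a) \<Rightarrow> 'a \<Rightarrow> bool" where
  "right_cancelable S m p \<longleftrightarrow> (\<forall>x\<in>S. \<forall>y\<in>S. m x p = m y p \<longrightarrow> x = y)"

text \<open>By \<open>is_beta_extension_iff\<close> such an extension exists and is unique on \<open>beta S\<close>.\<close>

definition is_beta_extension ::
  "'a set \<Rightarrow> 'b set \<Rightarrow> ('a \<Rightarrow> 'b) \<Rightarrow> ('a set set \<Rightarrow> 'b set set) \<Rightarrow> bool" where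
  "is_beta_extension S T h F \<longleftrightarrow>
     continuous_map (beta_topology S) (beta_topology T) F \<and>
     (\<forall>s\<in>S. F (principal_ultrafilter S s) = principal_ultrafilter T (h s))"


section \<open>The quotient \<open>T = S/\<sim>\<close>\<close>

definition cancel_rel :: "'a set \<Rightarrow> ('a \<Rightarrow> 'a \<Rightarrow> 'a) \<Rightarrow> ('a \<times> 'a) set" where
  "cancel_rel S m = {(a, b). a \<in> S \<and> b \<in> S \<and> (\<exists>x\<in>S. m a x = m b x)}"

definition quot_carrier :: "'a set \<Rightarrow> ('a \<Rightarrow> 'a \<Rightarrow> 'a) \<Rightarrow> 'a set set" where
  "quot_carrier S m = S // cancel_rel S m"

definition quot_proj :: "'a set \<Rightarrow> ('a \<Rightarrow> 'a \<Rightarrow> 'a) \<Rightarrow> 'a \<Rightarrow> 'a set" where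
  "quot_proj S m a = cancel_rel S m `` {a}"

text \<open>All the sets in the union coincide, since \<open>\<sim>\<close> is a congruence under SFC:
  \<open>quot_mult_proj\<close>.\<close>

definition quot_mult :: "'a set \<Rightarrow> ('a \<Rightarrow> 'a \<Rightarrow> 'a) \<Rightarrow> 'a set \<Rightarrow> 'a set \<Rightarrow> 'a set" where
  "quot_mult S m X Y = (\<Union>a\<in>X. \<Union>b\<in>Y. quot_proj S m (m a b))"


section \<open>Basic facts about \<open>beta\<close>\<close>

lemma betaD:
  assumes "p \<in> beta S"
  shows "\<And>A. A \<in> p \<Longrightarrow> A \<subseteq> S" "S \<in> p" "{} \<notin> p"
    "\<And>A B. A \<in> p \<Longrightarrow> B \<in> p \<Longrightarrow> A \<inter> B \<in> p"
    "\<And>A B. A \<in> p \<Longrightarrow> A \<subseteq> B \<Longrightarrow> B \<subseteq> S \<Longrightarrow> B \<in> p"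
    "\<And>A. A \<subseteq> S \<Longrightarrow> A \<in> p \<or> S - A \<in> p"
proof -
  have "p \<subseteq> Pow S" "S \<in> p" "{} \<notin> p"
    and I: "\<forall>A\<in>p. \<forall>B\<in>p. A \<inter> B \<in> p"
    and U: "\<forall>A\<in>p. \<forall>B. A \<subseteq> B \<and> B \<subseteq> S \<longrightarrow> B \<in> p"
    and D: "\<forall>A. A \<subseteq> S \<longrightarrow> A \<in> p \<or> S - A \<in> p"
    using assms by (simp_all add: beta_def is_ultrafilter_on_def)
  then show "\<And>A. A \<in> p \<Longrightarrow> A \<subseteq> S" "S \<in> p" "{} \<notin> p" by auto
  show "A \<inter> B \<in> p" if "A \<in> p" "B \<in> p" for A B using I that by simp
  show "B \<in> p" if "A \<in> p" "A \<subseteq> B" "B \<subseteq> S" for A B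
    using U[rule_format, of A B] that by simp
  show "A \<in> p \<or> S - A \<in> p" if "A \<subseteq> S" for A using D that by simp
qed

lemma betaI:
  assumes "\<And>A. A \<in> p \<Longrightarrow> A \<subseteq> S" "S \<in> p" "{} \<notin> p"
    "\<And>A B. A \<in> p \<Longrightarrow> B \<in> p \<Longrightarrow> A \<inter> B \<in> p"
    "\<And>A B. A \<in> p \<Longrightarrow> A \<subseteq> B \<Longrightarrow> B \<subseteq> S \<Longrightarrow> B \<in> p"
    "\<And>A. A \<subseteq> S \<Longrightarrow> A \<in> p \<or> S - A \<in> p"
  shows "p \<in> beta S"
proof -
  have "p \<subseteq> Pow S" using assms(1) by blast
  moreover have "\<forall>A\<in>p. \<forall>B\<in>p. A \<inter> B \<in> p" using assms(4) by simp
  moreover have "\<forall>A\<in>p. \<forall>B. A \<subseteq> B \<and> B \<subseteq> S \<longrightarrow> B \<in> p" using assms(5) by metis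
  moreover have "\<forall>A. A \<subseteq> S \<longrightarrow> A \<in> p \<or> S - A \<in> p" using assms(6) by simp
  ultimately show ?thesis using assms(2,3) by (simp add: beta_def is_ultrafilter_on_def)
qed

lemma beta_Int_iff:
  assumes "p \<in> beta S" "A \<subseteq> S" "B \<subseteq> S"
  shows "A \<inter> B \<in> p \<longleftrightarrow> A \<in> p \<and> B \<in> p"
  using betaD[OF assms(1)] assms(2,3) by (meson inf_le1 inf_le2)

lemma beta_Diff_iff:
  assumes "p \<in> beta S" "A \<subseteq> S"
  shows "S - A \<in> p \<longleftrightarrow> A \<notin> p"
  using betaD(3,4,6)[OF assms(1)] assms(2) by (metis Diff_disjoint)

lemma beta_eqI:
  assumes "p \<in> beta S" "q \<in> beta S" "p \<subseteq> q"
  shows "p = q"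
proof
  show "q \<subseteq> p"
  proof
    fix A assume A: "A \<in> q"
    have AS: "A \<subseteq> S" by (rule betaD(1)[OF assms(2) A])
    have "S - A \<notin> p" using A beta_Diff_iff[OF assms(2) AS] assms(3) by auto
    then show "A \<in> p" using beta_Diff_iff[OF assms(1) AS] by simp
  qed
qed fact

lemma principal_in_beta: "s \<in> S \<Longrightarrow> principal_ultrafilter S s \<in> beta S"
  by (rule betaI) (auto simp: principal_ultrafilter_def)

lemma topspace_beta [simp]: "topspace (beta_topology S) = beta S"
proof -
  have "beta S = {p \<in> beta S. S \<in> p}" using betaD(2) by blast
  then show ?thesis unfolding beta_topology_def by auto
qed

lemma openin_beta_basic: "A \<subseteq> S \<Longrightarrow> openin (beta_topology S) {p \<in> beta S. A \<in> p}"
  unfolding beta_topology_def by (rule topology_generated_by_Basis) auto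

lemma continuous_map_betaI:
  assumes "\<And>x. x \<in> topspace X \<Longrightarrow> f x \<in> beta T"
    and "\<And>A. A \<subseteq> T \<Longrightarrow> openin X {x \<in> topspace X. A \<in> f x}"
  shows "continuous_map X (beta_topology T) f"
  unfolding beta_topology_def
proof (rule continuous_on_generated_topo)
  fix U assume "U \<in> {{p \<in> beta T. A \<in> p} | A. A \<subseteq> T}"
  then obtain A where A: "A \<subseteq> T" "U = {p \<in> beta T. A \<in> p}" by blast
  have "f -` U \<inter> topspace X = {x \<in> topspace X. A \<in> f x}"
    using assms(1) A(2) by auto
  then show "openin X (f -` U \<inter> topspace X)" using assms(2)[OF A(1)] by simp
next
  show "f ` topspace X \<subseteq> \<Union> {{p \<in> beta T. A \<in> p} | A. A \<subseteq> T}"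
    using assms(1) betaD(2) by blast
qed

lemma continuous_map_beta_openin:
  assumes "continuous_map X (beta_topology T) f" "A \<subseteq> T"
  shows "openin X {x \<in> topspace X. A \<in> f x}"
proof -
  have "{x \<in> topspace X. A \<in> f x} = {x \<in> topspace X. f x \<in> {p \<in> beta T. A \<in> p}}"
    using continuous_map_image_subset_topspace[OF assms(1)] by auto
  then show ?thesis
    using openin_continuous_map_preimage[OF assms(1) openin_beta_basic[OF assms(2)]] by simp
qed


section \<open>Continuous extensions\<close>

definition beta_map :: "'a set \<Rightarrow> 'b set \<Rightarrow> ('a \<Rightarrow> 'b) \<Rightarrow> 'a set set \<Rightarrow> 'b set set" where
  "beta_map S T h p = {B. B \<subseteq> T \<and> {s \<in> S. h s \<in> B} \<in> p}"

lemma beta_map_in_beta: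
  assumes h: "\<And>s. s \<in> S \<Longrightarrow> h s \<in> T" and p: "p \<in> beta S"
  shows "beta_map S T h p \<in> beta T"
proof (rule betaI)
  show "T \<in> beta_map S T h p"
  proof -
    have "{s \<in> S. h s \<in> T} = S" using h by auto
    then show ?thesis using betaD(2)[OF p] by (simp add: beta_map_def)
  qed
  show "{} \<notin> beta_map S T h p" using betaD(3)[OF p] by (simp add: beta_map_def)
next
  fix A B assume "A \<in> beta_map S T h p" "B \<in> beta_map S T h p"
  moreover have "{s \<in> S. h s \<in> A \<inter> B} = {s \<in> S. h s \<in> A} \<inter> {s \<in> S. h s \<in> B}" by auto
  ultimately show "A \<inter> B \<in> beta_map S T h p"
    using betaD(4)[OF p] by (auto simp: beta_map_def)
next
  fix A B assume AB: "A \<in> beta_map S T h p" "A \<subseteq> B" "B \<subseteq> T"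
  have "{s \<in> S. h s \<in> B} \<in> p"
    by (rule betaD(5)[OF p, of "{s \<in> S. h s \<in> A}"]) (use AB in \<open>auto simp: beta_map_def\<close>)
  then show "B \<in> beta_map S T h p" using AB by (simp add: beta_map_def)
next
  fix A assume A: "A \<subseteq> T"
  have "{s \<in> S. h s \<in> T - A} = S - {s \<in> S. h s \<in> A}" using h by auto
  then show "A \<in> beta_map S T h p \<or> T - A \<in> beta_map S T h p"
    using betaD(6)[OF p, of "{s \<in> S. h s \<in> A}"] A by (auto simp: beta_map_def)
qed (simp add: beta_map_def)

lemma is_beta_extension_beta_map:
  assumes h: "\<And>s. s \<in> S \<Longrightarrow> h s \<in> T"
  shows "is_beta_extension S T h (beta_map S T h)"
  unfolding is_beta_extension_def
proof (intro conjI ballI)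
  show "continuous_map (beta_topology S) (beta_topology T) (beta_map S T h)"
  proof (rule continuous_map_betaI)
    fix A assume "A \<subseteq> T"
    then have "{x \<in> topspace (beta_topology S). A \<in> beta_map S T h x}
      = {p \<in> beta S. {s \<in> S. h s \<in> A} \<in> p}" by (auto simp: beta_map_def)
    then show "openin (beta_topology S) {x \<in> topspace (beta_topology S). A \<in> beta_map S T h x}"
      by (simp add: openin_beta_basic)
  qed (use beta_map_in_beta[where h = h] h in auto)
next
  fix s assume "s \<in> S"
  then show "beta_map S T h (principal_ultrafilter S s) = principal_ultrafilter T (h s)"
    by (auto simp: beta_map_def principal_ultrafilter_def)
qed

lemma beta_topology_basis:
  assumes "openin (beta_topology S) U" "p \<in> U"
  shows "\<exists>A\<in>p. {q \<in> beta S. A \<in> q} \<subseteq> U"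
proof -
  have pS: "p \<in> beta S" using openin_subset[OF assms(1)] assms(2) by auto
  have "generate_topology_on {{p \<in> beta S. A \<in> p} | A. A \<subseteq> S} U"
    using assms(1) unfolding beta_topology_def by (rule openin_topology_generated_by)
  then show ?thesis using assms(2)
  proof (induction rule: generate_topology_on.induct)
    case Empty
    then show ?case by simp
  next
    case (Int a b)
    from Int.prems have "p \<in> a" "p \<in> b" by simp_all
    from Int.IH(1)[OF this(1)] obtain A where A: "A \<in> p" "{q \<in> beta S. A \<in> q} \<subseteq> a" ..
    from Int.IH(2)[OF \<open>p \<in> b\<close>] obtain B where B: "B \<in> p" "{q \<in> beta S. B \<in> q} \<subseteq> b" ..
    have "A \<subseteq> S" "B \<subseteq> S"
      by (rule betaD(1)[OF pS A(1)], rule betaD(1)[OF pS B(1)])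
    then have "{q \<in> beta S. A \<inter> B \<in> q} \<subseteq> {q \<in> beta S. A \<in> q} \<inter> {q \<in> beta S. B \<in> q}"
      using beta_Int_iff[of _ S A B] by auto
    also have "\<dots> \<subseteq> a \<inter> b" by (rule Int_mono[OF A(2) B(2)])
    finally show ?case using betaD(4)[OF pS A(1) B(1)] by (rule bexI)
  next
    case (UN K)
    from UN.prems obtain k where k: "k \<in> K" "p \<in> k" ..
    from UN.IH[OF k] obtain A where A: "A \<in> p" "{q \<in> beta S. A \<in> q} \<subseteq> k" ..
    from A(2) Union_upper[OF k(1)] have "{q \<in> beta S. A \<in> q} \<subseteq> \<Union>K" by (rule subset_trans)
    then show ?case using A(1) by (rule bexI)
  next
    case (Basis V)
    then obtain A where A: "V = {q \<in> beta S. A \<in> q}" by auto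
    then have "A \<in> p" using Basis.prems by simp
    with A show ?case by (intro bexI[of _ A]) simp_all
  qed
qed

text \<open>The continuous extension exists and is unique on \<open>beta S\<close>.\<close>

lemma is_beta_extension_iff:
  assumes h: "\<And>s. s \<in> S \<Longrightarrow> h s \<in> T"
  shows "is_beta_extension S T h F \<longleftrightarrow> (\<forall>p\<in>beta S. F p = beta_map S T h p)"
proof
  assume F: "is_beta_extension S T h F"
  then have c: "continuous_map (beta_topology S) (beta_topology T) F"
    and e: "\<And>s. s \<in> S \<Longrightarrow> F (principal_ultrafilter S s) = principal_ultrafilter T (h s)"
    by (auto simp: is_beta_extension_def)
  show "\<forall>p\<in>beta S. F p = beta_map S T h p"
  proof
    fix p assume p: "p \<in> beta S"
    have Fp: "F p \<in> beta T" using continuous_map_image_subset_topspace[OF c] p by auto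
    show "F p = beta_map S T h p"
    proof (rule beta_eqI[OF Fp beta_map_in_beta[OF h p]])
      show "F p \<subseteq> beta_map S T h p"
      proof
        fix B assume B: "B \<in> F p"
        have BT: "B \<subseteq> T" using B betaD(1)[OF Fp] by blast
        have "openin (beta_topology S) {x \<in> topspace (beta_topology S). B \<in> F x}"
          by (rule continuous_map_beta_openin[OF c BT])
        then have "openin (beta_topology S) {x \<in> beta S. B \<in> F x}" by simp
        moreover have "p \<in> {x \<in> beta S. B \<in> F x}" using p B by simp
        ultimately have "\<exists>A\<in>p. {q \<in> beta S. A \<in> q} \<subseteq> {x \<in> beta S. B \<in> F x}"
          by (rule beta_topology_basis)
        then obtain A where A: "A \<in> p" "{q \<in> beta S. A \<in> q} \<subseteq> {x \<in> beta S. B \<in> F x}" ..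
        have AS: "A \<subseteq> S" using A(1) betaD(1)[OF p] by blast
        have "A \<subseteq> {s \<in> S. h s \<in> B}"
        proof
          fix s assume s: "s \<in> A"
          have sS: "s \<in> S" using s AS by blast
          have "principal_ultrafilter S s \<in> {x \<in> beta S. B \<in> F x}"
            using A(2) principal_in_beta[OF sS] s AS by (auto simp: principal_ultrafilter_def)
          then have "B \<in> principal_ultrafilter T (h s)" using e[OF sS] by auto
          then show "s \<in> {s \<in> S. h s \<in> B}" using sS by (auto simp: principal_ultrafilter_def)
        qed
        then have "{s \<in> S. h s \<in> B} \<in> p" using betaD(5)[OF p A(1)] by auto
        then show "B \<in> beta_map S T h p" using BT by (simp add: beta_map_def)
      qed
    qed
  qed
next
  assume eq: "\<forall>p\<in>beta S. F p = beta_map S T h p"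
  have b: "is_beta_extension S T h (beta_map S T h)"
    by (rule is_beta_extension_beta_map) (rule h)
  then show "is_beta_extension S T h F"
    unfolding is_beta_extension_def
    using eq principal_in_beta[of _ S] continuous_map_eq[of "beta_topology S" _ "beta_map S T h" F]
    by auto
qed


section \<open>The operation on \<open>beta S\<close>\<close>

lemma beta_mult_in_beta:
  assumes m: "\<And>x y. x \<in> S \<Longrightarrow> y \<in> S \<Longrightarrow> m x y \<in> S" and p: "p \<in> beta S" and q: "q \<in> beta S"
  shows "beta_mult S m p q \<in> beta S"
proof -
  define P where "P A = {x \<in> S. {y \<in> S. m x y \<in> A} \<in> q}" for A
  have PS: "P A \<subseteq> S" for A by (auto simp: P_def)
  have mem: "A \<in> beta_mult S m p q \<longleftrightarrow> A \<subseteq> S \<and> P A \<in> p" for A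
    by (simp add: beta_mult_def P_def)
  show ?thesis
  proof (rule betaI)
    have "{y \<in> S. m x y \<in> S} = S" if "x \<in> S" for x using m that by auto
    then have "P S = S" using betaD(2)[OF q] by (auto simp: P_def)
    then show "S \<in> beta_mult S m p q" using betaD(2)[OF p] by (simp add: mem)
    have "P {} = {}" using betaD(3)[OF q] by (simp add: P_def)
    then show "{} \<notin> beta_mult S m p q" using betaD(3)[OF p] by (simp add: mem)
  next
    fix A B assume AB: "A \<in> beta_mult S m p q" "B \<in> beta_mult S m p q"
    have eq: "{y \<in> S. m x y \<in> A \<inter> B} = {y \<in> S. m x y \<in> A} \<inter> {y \<in> S. m x y \<in> B}" for x
      by auto
    have "P A \<inter> P B \<subseteq> P (A \<inter> B)" unfolding P_def eq using betaD(4)[OF q] by auto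
    then have "P (A \<inter> B) \<in> p" using betaD(4,5)[OF p] AB PS mem by metis
    then show "A \<inter> B \<in> beta_mult S m p q" using AB by (auto simp: mem)
  next
    fix A B assume AB: "A \<in> beta_mult S m p q" "A \<subseteq> B" "B \<subseteq> S"
    have sub: "{y \<in> S. m x y \<in> A} \<subseteq> {y \<in> S. m x y \<in> B}" for x using AB(2) by auto
    have "P A \<subseteq> P B"
    proof
      fix x assume "x \<in> P A"
      then show "x \<in> P B" unfolding P_def using betaD(5)[OF q _ sub[of x]] by simp
    qed
    then have "P B \<in> p" using betaD(5)[OF p _ _ PS] AB(1) mem by blast
    then show "B \<in> beta_mult S m p q" using AB by (simp add: mem)
  next
    fix A assume A: "A \<subseteq> S"
    have eq: "{y \<in> S. m x y \<in> S - A} = S - {y \<in> S. m x y \<in> A}" if "x \<in> S" for x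
      using m that by auto
    have "{y \<in> S. m x y \<in> S - A} \<in> q \<longleftrightarrow> {y \<in> S. m x y \<in> A} \<notin> q" if "x \<in> S" for x
      unfolding eq[OF that] by (rule beta_Diff_iff[OF q]) auto
    then have "P (S - A) = S - P A" unfolding P_def by blast
    then show "A \<in> beta_mult S m p q \<or> S - A \<in> beta_mult S m p q"
      using betaD(6)[OF p PS[of A]] A by (auto simp: mem)
  qed (simp add: mem)
qed

lemma beta_mult_principal:
  assumes m: "\<And>x y. x \<in> S \<Longrightarrow> y \<in> S \<Longrightarrow> m x y \<in> S" and "s \<in> S" "t \<in> S"
  shows "beta_mult S m (principal_ultrafilter S s) (principal_ultrafilter S t) = principal_ultrafilter S (m s t)"
  using assms by (auto simp: beta_mult_def principal_ultrafilter_def)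

lemma continuous_beta_mult_right:
  assumes m: "\<And>x y. x \<in> S \<Longrightarrow> y \<in> S \<Longrightarrow> m x y \<in> S" and p: "p \<in> beta S"
  shows "continuous_map (beta_topology S) (beta_topology S) (\<lambda>x. beta_mult S m x p)"
proof (rule continuous_map_betaI)
  fix A assume "A \<subseteq> S"
  then have "{x \<in> topspace (beta_topology S). A \<in> beta_mult S m x p}
      = {x \<in> beta S. {s \<in> S. {y \<in> S. m s y \<in> A} \<in> p} \<in> x}"
    by (simp add: beta_mult_def)
  then show "openin (beta_topology S) {x \<in> topspace (beta_topology S). A \<in> beta_mult S m x p}"
    by (simp add: openin_beta_basic)
qed (use beta_mult_in_beta[where m = m, OF m] p in auto)

lemma continuous_beta_mult_left:
  assumes m: "\<And>x y. x \<in> S \<Longrightarrow> y \<in> S \<Longrightarrow> m x y \<in> S" and s: "s \<in> S"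
  shows "continuous_map (beta_topology S) (beta_topology S) (beta_mult S m (principal_ultrafilter S s))"
proof (rule continuous_map_betaI)
  fix A assume "A \<subseteq> S"
  then have "{x \<in> topspace (beta_topology S). A \<in> beta_mult S m (principal_ultrafilter S s) x}
      = {x \<in> beta S. {y \<in> S. m s y \<in> A} \<in> x}"
    using s by (auto simp: beta_mult_def principal_ultrafilter_def)
  then show "openin (beta_topology S)
      {x \<in> topspace (beta_topology S). A \<in> beta_mult S m (principal_ultrafilter S s) x}"
    by (simp add: openin_beta_basic)
qed (use beta_mult_in_beta[where m = m, OF m] principal_in_beta[OF s] in auto)


section \<open>Under SFC the quotient is a cancellative semigroup\<close>

lemma is_semigroupD:
  assumes "is_semigroup S m"
  shows "\<And>x y. x \<in> S \<Longrightarrow> y \<in> S \<Longrightarrow> m x y \<in> S"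
    "\<And>x y z. x \<in> S \<Longrightarrow> y \<in> S \<Longrightarrow> z \<in> S \<Longrightarrow> m (m x y) z = m x (m y z)"
  using assms unfolding is_semigroup_def by blast+

lemma SFC_card_Int:
  assumes "is_folner_set S m H \<epsilon> K" "s \<in> H"
  shows "real (card (K \<inter> m s ` K)) > (1 - \<epsilon>) * real (card K)"
proof -
  have "finite K" "real (card (K - m s ` K)) < \<epsilon> * real (card K)"
    using assms by (auto simp: is_folner_set_def)
  moreover have "card K = card (K \<inter> m s ` K) + card (K - m s ` K)"
    using \<open>finite K\<close> by (metis card_Int_Diff)
  ultimately show ?thesis by (simp add: algebra_simps)
qed

lemma card_image_le_card_image_subset:
  assumes "finite K" "J \<subseteq> K"
  shows "card (f ` K) \<le> card (f ` J) + card (K - J)"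
proof -
  have "f ` K = f ` J \<union> f ` (K - J)" using assms(2) by auto
  then have "card (f ` K) \<le> card (f ` J) + card (f ` (K - J))" by (simp add: card_Un_le)
  also have "card (f ` (K - J)) \<le> card (K - J)" using assms(1) by (intro card_image_le) simp
  finally show ?thesis by simp
qed

lemma SFC_left_reversible:
  assumes S: "SFC S m" and s: "s \<in> S" and t: "t \<in> S"
  shows "\<exists>u\<in>S. \<exists>v\<in>S. m s u = m t v"
proof -
  obtain K where K: "is_folner_set S m {s, t} (1/2) K"
    using S[unfolded SFC_def, rule_format, of "{s, t}" "1/2"] s t by auto
  then have fin: "finite K" "K \<subseteq> S" by (auto simp: is_folner_set_def)
  have "(K \<inter> m s ` K) \<inter> (K \<inter> m t ` K) \<noteq> {}"
  proof
    assume "(K \<inter> m s ` K) \<inter> (K \<inter> m t ` K) = {}"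
    then have "card (K \<inter> m s ` K) + card (K \<inter> m t ` K)
        = card ((K \<inter> m s ` K) \<union> (K \<inter> m t ` K))"
      using fin by (subst card_Un_disjoint) auto
    also have "\<dots> \<le> card K" using fin by (intro card_mono) auto
    finally show False
      using SFC_card_Int[OF K, of s] SFC_card_Int[OF K, of t] by simp
  qed
  then show ?thesis using fin by blast
qed

lemma equiv_cancel_rel:
  assumes sg: "is_semigroup S m" and S: "SFC S m"
  shows "equiv S (cancel_rel S m)"
proof (rule equivI)
  show "cancel_rel S m \<subseteq> S \<times> S" by (auto simp: cancel_rel_def)
  show "refl_on S (cancel_rel S m)" by (auto simp: cancel_rel_def refl_on_def)
  show "sym (cancel_rel S m)" by (rule symI) (auto simp: cancel_rel_def, metis)
  show "trans (cancel_rel S m)"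
  proof (rule transI)
    fix a b c assume "(a, b) \<in> cancel_rel S m" "(b, c) \<in> cancel_rel S m"
    then obtain x y where *: "a \<in> S" "b \<in> S" "c \<in> S" "x \<in> S" "y \<in> S"
      "m a x = m b x" "m b y = m c y"
      by (auto simp: cancel_rel_def)
    obtain u v where uv: "u \<in> S" "v \<in> S" "m x u = m y v"
      using SFC_left_reversible[OF S, of x y] * by blast
    note as = is_semigroupD(2)[OF sg]
    have "m a (m x u) = m (m b x) u" using as[of a x u] * uv(1) by simp
    also have "\<dots> = m (m b y) v" using as[of b x u] as[of b y v] * uv by simp
    also have "\<dots> = m c (m x u)" using as[of c y v] * uv by simp
    finally have "m a (m x u) = m c (m x u)" .
    moreover have "m x u \<in> S" using * uv is_semigroupD(1)[OF sg] by blast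
    ultimately show "(a, c) \<in> cancel_rel S m" using * by (auto simp: cancel_rel_def)
  qed
qed

lemma cancel_rel_mult:
  assumes sg: "is_semigroup S m" and S: "SFC S m" and c: "c \<in> S"
    and ab: "(a, b) \<in> cancel_rel S m"
  shows "(m c a, m c b) \<in> cancel_rel S m" "(m a c, m b c) \<in> cancel_rel S m"
proof -
  note [simp] = is_semigroupD[OF sg]
  from ab obtain x where x: "a \<in> S" "b \<in> S" "x \<in> S" "m a x = m b x"
    by (auto simp: cancel_rel_def)
  have "m (m c a) x = m (m c b) x" using x c by simp
  then have "\<exists>x\<in>S. m (m c a) x = m (m c b) x" using x(3) by blast
  then show "(m c a, m c b) \<in> cancel_rel S m" using x c unfolding cancel_rel_def by simp
  obtain u v where uv: "u \<in> S" "v \<in> S" "m x u = m c v"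
    using SFC_left_reversible[OF S, of x c] x c by blast
  note as = is_semigroupD(2)[OF sg]
  have "m (m a c) v = m (m a x) u" using as[of a c v] as[of a x u] uv x(1-3) c by simp
  also have "\<dots> = m (m b x) u" by (simp only: x(4))
  also have "\<dots> = m (m b c) v" using as[of b c v] as[of b x u] uv x(1-3) c by simp
  finally show "(m a c, m b c) \<in> cancel_rel S m"
    using x c uv(2) unfolding cancel_rel_def by auto
qed

lemma quot_mult_proj:
  assumes sg: "is_semigroup S m" and S: "SFC S m" and a: "a \<in> S" and b: "b \<in> S"
  shows "quot_mult S m (quot_proj S m a) (quot_proj S m b) = quot_proj S m (m a b)"
proof -
  note e = equiv_cancel_rel[OF sg S]
  have "congruent2 (cancel_rel S m) (cancel_rel S m) (\<lambda>a b. quot_proj S m (m a b))"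
    by (rule congruent2I[OF e e])
      (auto simp: quot_proj_def intro!: equiv_class_eq[OF e] cancel_rel_mult[OF sg S])
  from UN_equiv_class2[OF e e this a b] show ?thesis
    by (simp add: quot_mult_def quot_proj_def)
qed

lemma quot_proj_eq_iff:
  assumes "is_semigroup S m" "SFC S m" "a \<in> S" "b \<in> S"
  shows "quot_proj S m a = quot_proj S m b \<longleftrightarrow> (\<exists>x\<in>S. m a x = m b x)"
  using eq_equiv_class_iff[OF equiv_cancel_rel[OF assms(1,2)] assms(3,4)] assms(3,4)
  by (simp add: quot_proj_def cancel_rel_def)

lemma quot_carrier_eq: "quot_carrier S m = quot_proj S m ` S"
  by (auto simp: quot_carrier_def quot_proj_def quotient_def)

lemma is_semigroup_quot:
  assumes sg: "is_semigroup S m" and S: "SFC S m"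
  shows "is_semigroup (quot_carrier S m) (quot_mult S m)"
  using is_semigroupD[OF sg]
  by (auto simp: is_semigroup_def quot_carrier_eq quot_mult_proj[OF sg S])

text \<open>Left translations are almost injective on a Folner set, which yields left cancellation
  in the quotient.\<close>

lemma SFC_left_cancel:
  assumes S: "SFC S m" and u: "u \<in> S" and v: "v \<in> S" and c: "c \<in> S"
    and eq: "\<And>k. k \<in> S \<Longrightarrow> m c (m u k) = m c (m v k)"
  shows "\<exists>k\<in>S. m u k = m v k"
proof (rule ccontr)
  assume neg: "\<not> (\<exists>k\<in>S. m u k = m v k)"
  obtain K where K: "is_folner_set S m {u, v, c} (1/8) K"
    using S[unfolded SFC_def, rule_format, of "{u, v, c}" "1/8"] u v c by auto
  then have fin: "finite K" "K \<subseteq> S" "K \<noteq> {}" by (auto simp: is_folner_set_def)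
  define J where "J = {k \<in> K. m u k \<in> K \<and> m v k \<in> K}"
  define n where "n = real (card K)"
  have npos: "n > 0" using fin by (simp add: n_def card_gt_0_iff)
  have almost: "real (card {k \<in> K. m s k \<in> K}) > 7/8 * n" if "s \<in> {u, v, c}" for s
  proof -
    have "K \<inter> m s ` K \<subseteq> m s ` {k \<in> K. m s k \<in> K}" by auto
    then have "card (K \<inter> m s ` K) \<le> card {k \<in> K. m s k \<in> K}"
      using fin by (intro surj_card_le) auto
    then show ?thesis using SFC_card_Int[OF K that] by (simp add: n_def)
  qed
  have "card ({k \<in> K. m u k \<in> K} \<union> {k \<in> K. m v k \<in> K}) + card J
      = card {k \<in> K. m u k \<in> K} + card {k \<in> K. m v k \<in> K}"
  proof -
    have "J = {k \<in> K. m u k \<in> K} \<inter> {k \<in> K. m v k \<in> K}" by (auto simp: J_def)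
    then show ?thesis using fin card_Un_Int[of "{k \<in> K. m u k \<in> K}" "{k \<in> K. m v k \<in> K}"] by simp
  qed
  moreover have "card ({k \<in> K. m u k \<in> K} \<union> {k \<in> K. m v k \<in> K}) \<le> card K"
    using fin by (intro card_mono) auto
  ultimately have J: "real (card J) > 6/8 * n"
    using almost[of u] almost[of v] by (simp add: n_def)
  have img: "real (card (m s ` K)) > 7/8 * n" if "s \<in> {u, v, c}" for s
  proof -
    have "card (K \<inter> m s ` K) \<le> card (m s ` K)" using fin by (intro card_mono) auto
    then show ?thesis using SFC_card_Int[OF K that] by (simp add: n_def)
  qed
  \<comment> \<open>The set \<open>U\<close> of the \<open>uk\<close> with \<open>k \<in> J\<close> is large, and each of its points collides under \<open>c\<close>.\<close>
  define U where "U = m u ` J"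
  have U: "real (card U) > 5/8 * n"
  proof -
    have "card (m u ` K) \<le> card U + card (K - J)"
      unfolding U_def using fin by (intro card_image_le_card_image_subset) (auto simp: J_def)
    moreover have "card (K - J) = card K - card J" "card J \<le> card K"
      using fin by (auto simp: J_def intro!: card_Diff_subset card_mono)
    ultimately show ?thesis using img[of u] J by (simp add: n_def)
  qed
  \<comment> \<open>Count fibres: those meeting \<open>U\<close> have at least two points, those missing \<open>U\<close> at least one.\<close>
  have UK: "U \<subseteq> K" by (auto simp: U_def J_def)
  have coll: "\<exists>y\<in>K. y \<noteq> x \<and> m c y = m c x" if "x \<in> U" for x
  proof -
    from that obtain k where k: "k \<in> K" "m u k \<in> K" "m v k \<in> K" "x = m u k"
      by (auto simp: U_def J_def)
    have "k \<in> S" using k(1) fin by blast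
    then have "m v k \<noteq> x" "m c (m v k) = m c x" using eq[of k] neg k(4) by metis+
    then show ?thesis using k(3) by blast
  qed
  have two: "2 \<le> card {x \<in> K. m c x = y}" if "y \<in> m c ` U" for y
  proof -
    from that obtain x where x: "x \<in> U" "y = m c x" by blast
    with coll obtain z where z: "z \<in> K" "z \<noteq> x" "m c z = m c x" by blast
    have "card {x, z} \<le> card {x \<in> K. m c x = y}"
      using x z UK fin by (intro card_mono) auto
    then show ?thesis using z by simp
  qed
  have "card K = (\<Sum>y\<in>m c ` K. card {x \<in> K. m c x = y})"
    using sum.image_gen[OF fin(1), of "\<lambda>_. 1::nat" "m c"] by simp
  also have "\<dots> = (\<Sum>y\<in>m c ` K - m c ` U. card {x \<in> K. m c x = y})
      + (\<Sum>y\<in>m c ` U. card {x \<in> K. m c x = y})"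
    using fin UK by (intro sum.subset_diff) auto
  also have "\<dots> \<ge> card (m c ` K - m c ` U) + 2 * card (m c ` U)"
  proof (rule add_mono)
    have "1 \<le> card {x \<in> K. m c x = y}" if "y \<in> m c ` K" for y
      using that fin by (auto simp: Suc_le_eq card_gt_0_iff)
    then have "(\<Sum>y\<in>m c ` K - m c ` U. 1) \<le> (\<Sum>y\<in>m c ` K - m c ` U. card {x \<in> K. m c x = y})"
      by (intro sum_mono) auto
    then show "card (m c ` K - m c ` U) \<le> (\<Sum>y\<in>m c ` K - m c ` U. card {x \<in> K. m c x = y})"
      by simp
    have "(\<Sum>y\<in>m c ` U. 2) \<le> (\<Sum>y\<in>m c ` U. card {x \<in> K. m c x = y})"
      by (intro sum_mono two)
    then show "2 * card (m c ` U) \<le> (\<Sum>y\<in>m c ` U. card {x \<in> K. m c x = y})" by simp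
  qed
  finally have A: "card (m c ` K - m c ` U) + 2 * card (m c ` U) \<le> card K" .
  have finU: "finite U" using UK fin finite_subset by blast
  have "card (m c ` K - m c ` U) = card (m c ` K) - card (m c ` U)"
    "card (m c ` U) \<le> card (m c ` K)"
    using fin UK finU by (auto intro!: card_Diff_subset card_mono)
  with A have B: "real (card (m c ` K)) + real (card (m c ` U)) \<le> n" by (simp add: n_def)
  have "card (m c ` K) \<le> card (m c ` U) + card (K - U)"
    by (rule card_image_le_card_image_subset[OF fin(1) UK])
  moreover have "card (K - U) = card K - card U" "card U \<le> card K"
    using fin UK finU by (auto intro!: card_Diff_subset card_mono)
  ultimately have "real (card (m c ` K)) \<le> real (card (m c ` U)) + n - real (card U)"
    by (simp add: n_def)
  with B img[of c] U npos show False by simp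
qed

lemma is_cancellative_quot:
  assumes sg: "is_semigroup S m" and S: "SFC S m"
  shows "is_cancellative (quot_carrier S m) (quot_mult S m)"
proof -
  note cl = is_semigroupD(1)[OF sg] and as = is_semigroupD(2)[OF sg]
  have L: "\<exists>x\<in>S. m a x = m b x"
    if abc: "a \<in> S" "b \<in> S" "c \<in> S" and x: "x \<in> S" "m (m c a) x = m (m c b) x" for a b c x
  proof -
    have "m c (m (m a x) k) = m c (m (m b x) k)" if "k \<in> S" for k
    proof -
      have "m c (m (m d x) k) = m (m (m c d) x) k" if "d \<in> S" for d
        using as cl abc x(1) that \<open>k \<in> S\<close> by simp
      then show ?thesis using x(2) abc by simp
    qed
    then obtain k where "k \<in> S" "m (m a x) k = m (m b x) k"
      using SFC_left_cancel[OF S, of "m a x" "m b x" c] abc x(1) cl by blast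
    then show ?thesis using as cl abc x(1) by (intro bexI[of _ "m x k"]) auto
  qed
  have R: "\<exists>x\<in>S. m a x = m b x"
    if "a \<in> S" "b \<in> S" "c \<in> S" "x \<in> S" "m (m a c) x = m (m b c) x" for a b c x
    using that as cl by (intro bexI[of _ "m c x"]) auto
  note pe = quot_proj_eq_iff[OF sg S]
  have Lq: "a \<in> S \<Longrightarrow> b \<in> S \<Longrightarrow> c \<in> S \<Longrightarrow> quot_proj S m (m c a) = quot_proj S m (m c b)
      \<Longrightarrow> quot_proj S m a = quot_proj S m b" for a b c
    using L[of a b c] by (auto simp: pe[of "m c a" "m c b"] pe[of a b] cl)
  have Rq: "a \<in> S \<Longrightarrow> b \<in> S \<Longrightarrow> c \<in> S \<Longrightarrow> quot_proj S m (m a c) = quot_proj S m (m b c)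
      \<Longrightarrow> quot_proj S m a = quot_proj S m b" for a b c
    using R[of a b c] by (auto simp: pe[of "m a c" "m b c"] pe[of a b] cl)
  show ?thesis
    unfolding is_cancellative_def quot_carrier_eq ball_simps
  proof (intro ballI conjI impI)
    fix a b c assume abc: "a \<in> S" "b \<in> S" "c \<in> S"
    show "quot_proj S m a = quot_proj S m b"
      if "quot_mult S m (quot_proj S m c) (quot_proj S m a)
        = quot_mult S m (quot_proj S m c) (quot_proj S m b)"
      using that abc Lq[of a b c] by (simp add: quot_mult_proj[OF sg S])
    show "quot_proj S m a = quot_proj S m b"
      if "quot_mult S m (quot_proj S m a) (quot_proj S m c)
        = quot_mult S m (quot_proj S m b) (quot_proj S m c)"
      using that abc Rq[of a b c] by (simp add: quot_mult_proj[OF sg S])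
  qed
qed

end

(* If a x = b x, then left translation by a and by b agree on the right ideal x S. Its complement
   misses x K for every K, so it has Folner density 0; hence x S belongs to every p in Delta S, and
   a p = b p. If p is right cancelable this forces a = b, so the projection is a bijection. *)
theory Submission
  imports Defs
begin

text \<open>Functoriality, with \<open>beta_map_id_on\<close> for identities: preimages compose.
  This is what turns an inverse on the underlying sets into an inverse on the
  compactifications.\<close>

lemma beta_map_compose:
  assumes "\<And>s. s \<in> S \<Longrightarrow> f s \<in> T"
  shows "beta_map T U g (beta_map S T f p) = beta_map S U (\<lambda>s. g (f s)) p"
proof -
  have "{s \<in> S. f s \<in> {t \<in> T. g t \<in> B}} = {s \<in> S. g (f s) \<in> B}" for B
    using assms by auto
  then show ?thesis by (auto simp: beta_map_def)
qed

lemma beta_map_id_on: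
  assumes "p \<in> beta S" and "\<And>s. s \<in> S \<Longrightarrow> f s = s"
  shows "beta_map S S f p = p"
proof -
  have "{s \<in> S. f s \<in> B} = B" if "B \<subseteq> S" for B
    using assms(2) that by auto
  then show ?thesis using betaD(1)[OF assms(1)] by (auto simp: beta_map_def)
qed

text \<open>By functoriality, the extension of the inverse bijection is a two-sided inverse.\<close>

lemma bij_betw_beta_map:
  assumes h: "bij_betw h S T"
  shows "bij_betw (beta_map S T h) (beta S) (beta T)"
proof (rule bij_betw_byWitness[where f' = "beta_map T S (inv_into S h)"])
  note hT = bij_betwE[OF h, rule_format]
    and gS = bij_betwE[OF bij_betw_inv_into[OF h], rule_format]
  show "\<forall>p\<in>beta S. beta_map T S (inv_into S h) (beta_map S T h p) = p"
    using h by (simp add: beta_map_compose hT beta_map_id_on bij_betw_inv_into_left)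
  show "\<forall>q\<in>beta T. beta_map S T h (beta_map T S (inv_into S h) q) = q"
    using h by (simp add: beta_map_compose gS beta_map_id_on bij_betw_inv_into_right)
  show "beta_map S T h ` beta S \<subseteq> beta T"
    using beta_map_in_beta[of S h T] hT by blast
  show "beta_map T S (inv_into S h) ` beta T \<subseteq> beta S"
    using beta_map_in_beta[of T "inv_into S h" S] gS by blast
qed

text \<open>Both sides test whether \<open>p\<close>-many \<open>x\<close> have
  \<open>q\<close>-many \<open>y\<close> with \<open>h (m x y)\<close> in \<open>B\<close>; the
  homomorphism law lets \<open>h\<close> be applied before or after multiplying.\<close>

lemma beta_map_mult:
  assumes m: "\<And>x y. x \<in> S \<Longrightarrow> y \<in> S \<Longrightarrow> m x y \<in> S"
    and hT: "\<And>x. x \<in> S \<Longrightarrow> h x \<in> T"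
    and hm: "\<And>x y. x \<in> S \<Longrightarrow> y \<in> S \<Longrightarrow> h (m x y) = n (h x) (h y)"
  shows "beta_map S T h (beta_mult S m p q) = beta_mult T n (beta_map S T h p) (beta_map S T h q)"
proof -
  have inner: "{y \<in> S. m x y \<in> {s \<in> S. h s \<in> B}} = {y \<in> S. h y \<in> {t \<in> T. n (h x) t \<in> B}}"
    if "x \<in> S" for x B
    using m hT hm that by auto
  have outer: "{x \<in> S. {y \<in> S. m x y \<in> {s \<in> S. h s \<in> B}} \<in> q}
      = {x \<in> S. h x \<in> {t \<in> T. {u \<in> T. n t u \<in> B} \<in> beta_map S T h q}}" for B
  proof (intro Collect_cong conj_cong refl)
    fix x assume x: "x \<in> S"
    show "{y \<in> S. m x y \<in> {s \<in> S. h s \<in> B}} \<in> q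
        \<longleftrightarrow> h x \<in> {t \<in> T. {u \<in> T. n t u \<in> B} \<in> beta_map S T h q}"
      unfolding inner[OF x] using hT[OF x] by (simp add: beta_map_def)
  qed
  have "B \<in> beta_map S T h (beta_mult S m p q)
      \<longleftrightarrow> B \<in> beta_mult T n (beta_map S T h p) (beta_map S T h q)" for B
  proof -
    have "B \<in> beta_map S T h (beta_mult S m p q) \<longleftrightarrow>
        B \<subseteq> T \<and> {x \<in> S. {y \<in> S. m x y \<in> {s \<in> S. h s \<in> B}} \<in> q} \<in> p"
      \<comment> \<open>\<open>Collect_restrict\<close> discharges the requirement in
        \<open>beta_mult_def\<close> that a member be a subset of the carrier.\<close>
      by (simp only: beta_map_def beta_mult_def mem_Collect_eq Collect_restrict simp_thms)
    also have "\<dots> \<longleftrightarrow> B \<subseteq> T \<and>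
        {x \<in> S. h x \<in> {t \<in> T. {u \<in> T. n t u \<in> B} \<in> beta_map S T h q}} \<in> p"
      by (simp only: outer)
    also have "\<dots> \<longleftrightarrow> B \<in> beta_mult T n (beta_map S T h p) (beta_map S T h q)"
      by (simp only: beta_map_def[of S T h p] beta_mult_def mem_Collect_eq Collect_restrict simp_thms)
    finally show ?thesis .
  qed
  then show ?thesis by blast
qed

text \<open>A positive supremum has a positive element of the set below it. This gives one \<alpha>
  that serves all \<open>H\<close> and \<epsilon>, so that \<epsilon> may later be chosen in terms
  of \<alpha>.\<close>

lemma folner_density_pos_large:
  assumes S: "SFC S m" and pos: "folner_density S m A > 0"
  shows "\<exists>\<alpha>>0. \<forall>H \<epsilon>. finite H \<and> H \<noteq> {} \<and> H \<subseteq> S \<and> \<epsilon> > 0 \<longrightarrow>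
    (\<exists>K. is_folner_set S m H \<epsilon> K \<and> real (card (A \<inter> K)) \<ge> \<alpha> * real (card K))"
proof -
  define X where "X = {\<alpha> \<in> {0..1::real}. \<forall>H \<epsilon>. finite H \<and> H \<noteq> {} \<and> H \<subseteq> S \<and> \<epsilon> > 0 \<longrightarrow>
    (\<exists>K. is_folner_set S m H \<epsilon> K \<and> real (card (A \<inter> K)) \<ge> \<alpha> * real (card K))}"
  \<comment> \<open>For \<alpha> = 0 the bound on \<open>A \<inter> K\<close> is trivial and SFC
    itself supplies \<open>K\<close>; a nonempty bounded \<open>X\<close> makes \<open>Sup X\<close>
    a true supremum.\<close>
  have "0 \<in> X" using S by (auto simp: X_def SFC_def)
  moreover have "Sup X > 0" using pos by (simp add: folner_density_def X_def)
  moreover have "bdd_above X" by (rule bdd_aboveI[of _ 1]) (simp add: X_def)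
  ultimately obtain \<alpha> where "\<alpha> \<in> X" "\<alpha> > 0" using less_cSup_iff[of X 0] by auto
  then show ?thesis by (auto simp: X_def)
qed

lemma right_ideal_in_Delta:
  assumes sg: "is_semigroup S m" and S: "SFC S m" and p: "p \<in> Delta S m" and x: "x \<in> S"
  shows "m x ` S \<in> p"
proof (rule ccontr)
  assume "m x ` S \<notin> p"
  moreover have pb: "p \<in> beta S" using p by (simp add: Delta_def)
  moreover have "m x ` S \<subseteq> S" using is_semigroupD(1)[OF sg] x by auto
  ultimately have "S - m x ` S \<in> p" using betaD(6) by blast
  then have "folner_density S m (S - m x ` S) > 0" using p by (simp add: Delta_def)
  from folner_density_pos_large[OF S this] obtain \<alpha> where "\<alpha> > 0"
    and \<alpha>: "\<And>H \<epsilon>. finite H \<and> H \<noteq> {} \<and> H \<subseteq> S \<and> \<epsilon> > 0 \<Longrightarrow>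
      \<exists>K. is_folner_set S m H \<epsilon> K \<and> real (card ((S - m x ` S) \<inter> K)) \<ge> \<alpha> * real (card K)"
    by blast
  \<comment> \<open>With the density bound \<alpha> reused as the Folner tolerance, fewer than
    \<alpha> |K| points of \<open>K\<close> lie outside \<open>x K\<close>, while at least \<alpha>
    |K| of them lie outside \<open>x S\<close>. Since \<open>x K\<close> is contained in
    \<open>x S\<close>, these two bounds collide.\<close>
  obtain K where K: "is_folner_set S m {x} \<alpha> K"
    "real (card ((S - m x ` S) \<inter> K)) \<ge> \<alpha> * real (card K)"
    using \<alpha>[of "{x}" \<alpha>] x \<open>\<alpha> > 0\<close> by auto
  have "card ((S - m x ` S) \<inter> K) \<le> card (K - m x ` K)"
    using K(1) by (intro card_mono) (auto simp: is_folner_set_def)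
  with K show False by (simp add: is_folner_set_def)
qed

lemma cancel_rel_beta_mult_eq:
  assumes sg: "is_semigroup S m" and S: "SFC S m" and p: "p \<in> Delta S m"
    and ab: "(a, b) \<in> cancel_rel S m"
  shows "beta_mult S m (principal_ultrafilter S a) p = beta_mult S m (principal_ultrafilter S b) p"
proof -
  from ab obtain x where x: "a \<in> S" "b \<in> S" "x \<in> S" "m a x = m b x"
    by (auto simp: cancel_rel_def)
  \<comment> \<open>For \<open>y = x s\<close>, associativity gives
    \<open>a (x s) = (a x) s = (b x) s = b (x s)\<close>.\<close>
  have eq: "m a y = m b y" if "y \<in> m x ` S" for y
    using that x by (auto simp flip: is_semigroupD(2)[OF sg])
  have pb: "p \<in> beta S" using p by (simp add: Delta_def)
  have xp: "m x ` S \<in> p" by (rule right_ideal_in_Delta[OF sg S p x(3)])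
  have "{y \<in> S. m a y \<in> A} \<in> p \<longleftrightarrow> {y \<in> S. m b y \<in> A} \<in> p" for A
  proof -
    \<comment> \<open>Membership in an ultrafilter depends only on the trace on one of its members,
      here \<open>x S\<close>.\<close>
    have "m x ` S \<inter> {y \<in> S. m a y \<in> A} = m x ` S \<inter> {y \<in> S. m b y \<in> A}" using eq by auto
    then show ?thesis
      using beta_Int_iff[OF pb betaD(1)[OF pb xp], of "{y \<in> S. m a y \<in> A}"]
        beta_Int_iff[OF pb betaD(1)[OF pb xp], of "{y \<in> S. m b y \<in> A}"] xp by simp
  qed
  then show ?thesis using x(1,2) by (auto simp: beta_mult_def principal_ultrafilter_def)
qed

lemma principal_ultrafilter_inject:
  assumes "a \<in> S" and "principal_ultrafilter S a = principal_ultrafilter S b"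
  shows "a = b"
proof -
  \<comment> \<open>The singleton of \<open>a\<close> separates the two points.\<close>
  have "{a} \<in> principal_ultrafilter S a"
    using assms(1) by (simp add: principal_ultrafilter_def)
  then have "{a} \<in> principal_ultrafilter S b"
    by (simp only: assms(2))
  then show ?thesis by (simp add: principal_ultrafilter_def)
qed

theorem theorem3p10:
  fixes S :: "'a set" and m :: "'a \<Rightarrow> 'a \<Rightarrow> 'a"
    and htilde :: "'a set set \<Rightarrow> 'a set set set"
  assumes "is_semigroup S m"
    and "SFC S m"
    and "is_beta_extension S (quot_carrier S m) (quot_proj S m) htilde"
    and "\<exists>p \<in> Delta S m. right_cancelable (beta S) (beta_mult S m) p"
  shows "is_semigroup_iso
           (beta S) (beta_mult S m)
           (beta (quot_carrier S m)) (beta_mult (quot_carrier S m) (quot_mult S m))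
           htilde"
proof -
  let ?T = "quot_carrier S m" and ?h = "quot_proj S m"
  note sg = assms(1) and S = assms(2)
  obtain p where p: "p \<in> Delta S m" and rc: "right_cancelable (beta S) (beta_mult S m) p"
    using assms(4) by blast
  have hT: "?h s \<in> ?T" if "s \<in> S" for s using that by (simp add: quot_carrier_eq)
  have "inj_on ?h S"
  proof (rule inj_onI)
    fix a b assume ab: "a \<in> S" "b \<in> S" "?h a = ?h b"
    then have "(a, b) \<in> cancel_rel S m"
      using quot_proj_eq_iff[OF sg S] by (simp add: cancel_rel_def)
    \<comment> \<open>Right cancelability in \<open>beta S\<close> removes \<open>p\<close> from
      \<open>a p = b p\<close>, with \<open>a\<close> and \<open>b\<close> read as principal
      ultrafilters.\<close>
    then have "principal_ultrafilter S a = principal_ultrafilter S b"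
      using cancel_rel_beta_mult_eq[OF sg S p] rc principal_in_beta[of a S] principal_in_beta[of b S] ab(1,2)
      by (simp add: right_cancelable_def)
    then show "a = b" by (rule principal_ultrafilter_inject[OF ab(1)])
  qed
  then have "bij_betw (beta_map S ?T ?h) (beta S) (beta ?T)"
    by (intro bij_betw_beta_map) (simp add: bij_betw_def quot_carrier_eq)
  \<comment> \<open>Uniqueness of the continuous extension replaces the abstract
    \<open>htilde\<close> by the explicit preimage formula, but only on
    \<open>beta S\<close>.\<close>
  moreover have ext: "htilde q = beta_map S ?T ?h q" if "q \<in> beta S" for q
    using assms(3) that by (simp add: is_beta_extension_iff[where h = ?h, OF hT])
  ultimately have "bij_betw htilde (beta S) (beta ?T)"
    by (simp cong: bij_betw_cong)
  moreover have "htilde (beta_mult S m q r) = beta_mult ?T (quot_mult S m) (htilde q) (htilde r)"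
    if "q \<in> beta S" "r \<in> beta S" for q r
  proof -
    \<comment> \<open>Closure is what allows \<open>ext\<close> to be applied to the product as
      well.\<close>
    have "beta_mult S m q r \<in> beta S"
      by (rule beta_mult_in_beta[where m = m, OF is_semigroupD(1)[OF sg] that])
    then show ?thesis
      using that beta_map_mult[of S m ?h ?T "quot_mult S m" q r]
      by (simp add: ext hT is_semigroupD(1)[OF sg] quot_mult_proj[OF sg S])
  qed
  ultimately show ?thesis by (simp add: is_semigroup_iso_def)
qed

end
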